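(* Let $X\in\mathbb{R}^{p_1\times\cdots\times p_K\times n}$ be an observed data array, let $p=\prod_{k=1}^K p_k$, and let $X = \ell(L_1,\ldots,L_K,I_n)\cdot Q$ be the incredible HOLQ of $X$. Consider the multilinear normal model $X \sim N_{p_1\times\cdots\times p_K\times n}(0,\sigma^2 I_n\otimes\Sigma_K\otimes\cdots\otimes\Sigma_1)$ with unknown parameters $\sigma^2>0$ and $\Sigma_k\in\mathcal{S}_{p_k}^1$ for $k=1,\ldots,K$. Then: 1. The MLE of $\Sigma_k$ is $\hat{\Sigma}_k = L_kL_k^T$ for $k = 1,\ldots,K$. 2. The MLE of $\sigma^2$ is $\hat{\sigma}^2 = \ell^2 / (np)$. 3. The maximized likelihood is equal to $$\left(2 \pi \hat{\sigma}^2\right)^{-np/2}e^{-np/2} = \left(2 \pi \ell^2/(np)\right)^{-np/2}e^{-np/2}.$$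
   Context: $\mathcal{S}_{p}^1$ is the set of $p\times p$ symmetric positive definite matrices with unit determinant, and $\mathcal{G}_{p}^+$ is the set of $p \times p$ real lower triangular matrices with positive diagonal elements and unit determinant; $\|\cdot\|$ is the Frobenius norm. For matrices $A_k \in \mathbb{R}^{p_k \times p_k}$ and an array $Y \in \mathbb{R}^{p_1\times\cdots\times p_K\times n}$, multilinear multiplication $(A_1,\ldots,A_K,I_n)\cdot Y$ is the array of the same dimensions with entries $$\sum_{i_1,\ldots,i_K=1}^{p_1,\ldots,p_K} Y_{[i_1,\ldots,i_K,j_{K+1}]}\,A_{1[j_1,i_1]}\cdots A_{K[j_K,i_K]}.$$ Incredible HOLQ: if $(L_1,\ldots,L_K)$ attains the minimum $$(L_1,\ldots,L_K) = \operatorname*{arg\,min}_{\tilde{L}_k \in \mathcal{G}_{p_k}^+,\ k = 1,\ldots,K}\| (\tilde{L}_1^{-1},\ldots,\tilde{L}_K^{-1},I_n) \cdot X\|,$$ then $X = \ell (L_1,\ldots,L_K,I_n) \cdot Q$ is an incredible HOLQ of $X$, where $\ell = \| (L_1^{-1},\ldots,L_K^{-1},I_n) \cdot X\|$ and $Q = (L_1^{-1},\ldots,L_K^{-1},I_n) \cdot X / \ell$. It is understood that the minimizer exists and $\ell>0$. Model: $X \sim N_{p_1\times\cdots\times p_K\times n}(0,\sigma^2 I_n\otimes\Sigma_K\otimes\cdots\otimes\Sigma_1)$ means that $\mathrm{vec}(X)$ (stacking entries with the first index varying fastest) is a mean-zero normal vector in $\mathbb{R}^{np}$ with covariance $\sigma^2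 (I_n\otimes\Sigma_K\otimes\cdots\otimes\Sigma_1)$; equivalently $X \overset{d}{=} \sigma(\Sigma_1^{1/2},\ldots,\Sigma_K^{1/2},I_n)\cdot Z$, where $Z$ has i.i.d. standard normal entries and $\Sigma_k^{1/2}$ is the lower triangular Cholesky square root of $\Sigma_k$. The MLE is the parameter value $(\sigma^2,\Sigma_1,\dots,\Sigma_K)$ maximizing the joint density of $X$ (the likelihood) over the parameter space $(0,\infty)\times\mathcal{S}_{p_1}^1\times\cdots\times\mathcal{S}_{p_K}^1$. *)

theory Defs
  imports
    Complex_Main
    "HOL-Library.FuncSet"
    "Jordan_Normal_Form.Determinant"
    "Jordan_Normal_Form.Gauss_Jordan_Elimination"
begin

text \<open>
  A real array of dimensions \<open>p 1 \<times> \<dots> \<times> p K \<times> n\<close> is a function taking a multi-index for the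
  first \<open>K\<close> modes and an index for the last mode. The modes are numbered from 1 to \<open>K\<close>; as for the
  matrices of the library, positions within a mode start at 0. Only the values at indices within
  these bounds are meaningful, and likewise only the members \<open>1, \<dots>, K\<close> of a family of matrices
  \<open>nat \<Rightarrow> real mat\<close>.
\<close>

type_synonym array = "(nat \<Rightarrow> nat) \<Rightarrow> nat \<Rightarrow> real"

definition multi_indices :: "nat \<Rightarrow> (nat \<Rightarrow> nat) \<Rightarrow> (nat \<Rightarrow> nat) set" where
  "multi_indices K p = (\<Pi>\<^sub>E k\<in>{1..K}. {..<p k})"

definition array_eq :: "nat \<Rightarrow> (nat \<Rightarrow> nat) \<Rightarrow> nat \<Rightarrow> array \<Rightarrow> array \<Rightarrow> bool" where
  "array_eq K p n Y Z \<longleftrightarrow> (\<forall>i\<in>multi_indices K p. \<forall>j<n. Y i j = Z i j)"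

definition frobenius_norm :: "nat \<Rightarrow> (nat \<Rightarrow> nat) \<Rightarrow> nat \<Rightarrow> array \<Rightarrow> real" where
  "frobenius_norm K p n Y = sqrt (\<Sum>i\<in>multi_indices K p. \<Sum>j<n. (Y i j)\<^sup>2)"

text \<open>The product \<open>(A 1, \<dots>, A K, I) \<cdot> Y\<close>, with the identity acting on the last mode.\<close>

definition multilinear :: "nat \<Rightarrow> (nat \<Rightarrow> nat) \<Rightarrow> (nat \<Rightarrow> real mat) \<Rightarrow> array \<Rightarrow> array" where
  "multilinear K p A Y = (\<lambda>j m. \<Sum>i\<in>multi_indices K p. Y i m * (\<Prod>k=1..K. A k $$ (j k, i k)))"

text \<open>The inverse is only used for invertible matrices, where \<open>mat_inverse\<close> is not \<open>None\<close>.\<close>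

abbreviation minv :: "real mat \<Rightarrow> real mat" where
  "minv A \<equiv> the (mat_inverse A)"

definition spd_unit_det :: "nat \<Rightarrow> real mat set" where
  "spd_unit_det d = {A \<in> carrier_mat d d.
     transpose_mat A = A \<and>
     (\<forall>v\<in>carrier_vec d. v \<noteq> 0\<^sub>v d \<longrightarrow> v \<bullet> (A *\<^sub>v v) > 0) \<and>
     det A = 1}"

definition lower_tri_unit_det :: "nat \<Rightarrow> real mat set" where
  "lower_tri_unit_det d = {A \<in> carrier_mat d d.
     (\<forall>i<d. \<forall>j<d. i < j \<longrightarrow> A $$ (i, j) = 0) \<and>
     (\<forall>i<d. A $$ (i, i) > 0) \<and>
     det A = 1}"


subsection \<open>The incredible HOLQ\<close>

definition holq_objective ::
    "nat \<Rightarrow> (nat \<Rightarrow> nat) \<Rightarrow> nat \<Rightarrow> array \<Rightarrow> (nat \<Rightarrow> real mat) \<Rightarrow> real" where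
  "holq_objective K p n X M = frobenius_norm K p n (multilinear K p (\<lambda>k. minv (M k)) X)"

definition incredible_HOLQ ::
    "nat \<Rightarrow> (nat \<Rightarrow> nat) \<Rightarrow> nat \<Rightarrow> array \<Rightarrow> real \<Rightarrow> (nat \<Rightarrow> real mat) \<Rightarrow> array \<Rightarrow> bool" where
  "incredible_HOLQ K p n X l L Q \<longleftrightarrow>
     is_arg_min (holq_objective K p n X) (\<lambda>M. \<forall>k\<in>{1..K}. M k \<in> lower_tri_unit_det (p k)) L \<and>
     l = holq_objective K p n X L \<and> l > 0 \<and>
     array_eq K p n Q (\<lambda>i j. multilinear K p (\<lambda>k. minv (L k)) X i j / l) \<and>
     array_eq K p n X (\<lambda>i j. l * multilinear K p L Q i j)"


subsection \<open>The multilinear normal model\<close>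

definition kronecker :: "real mat \<Rightarrow> real mat \<Rightarrow> real mat" where
  "kronecker A B = mat (dim_row A * dim_row B) (dim_col A * dim_col B)
     (\<lambda>(i, j). A $$ (i div dim_row B, j div dim_col B) * B $$ (i mod dim_row B, j mod dim_col B))"

text \<open>\<open>kronecker_family S K\<close> is the product of \<open>S K, \<dots>, S 1\<close> in this order.\<close>

primrec kronecker_family :: "(nat \<Rightarrow> real mat) \<Rightarrow> nat \<Rightarrow> real mat" where
  "kronecker_family S 0 = 1\<^sub>m 1"
| "kronecker_family S (Suc k) = kronecker (S (Suc k)) (kronecker_family S k)"

text \<open>
  Vectorization with the first index varying fastest: position \<open>r\<close> holds the entry whose indices
  are the mixed-radix digits of \<open>r\<close>, with least significant digit in mode 1 and the leading digit
  in the last mode.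
\<close>

definition vectorize :: "nat \<Rightarrow> (nat \<Rightarrow> nat) \<Rightarrow> nat \<Rightarrow> array \<Rightarrow> real vec" where
  "vectorize K p n Y = vec (n * (\<Prod>k=1..K. p k))
     (\<lambda>r. Y (\<lambda>k\<in>{1..K}. (r div (\<Prod>m=1..<k. p m)) mod p k) (r div (\<Prod>k=1..K. p k)))"

text \<open>Density at \<open>v\<close> of the normal distribution with mean zero and nonsingular covariance \<open>C\<close>.\<close>

definition mvn_density :: "real mat \<Rightarrow> real vec \<Rightarrow> real" where
  "mvn_density C v =
     exp (- (v \<bullet> (minv C *\<^sub>v v)) / 2) / sqrt ((2 * pi) ^ dim_vec v * det C)"

text \<open>A parameter value is a pair of the variance and the family of matrices \<open>\<Sigma> 1, \<dots>, \<Sigma> K\<close>.\<close>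

definition parameter_space :: "nat \<Rightarrow> (nat \<Rightarrow> nat) \<Rightarrow> (real \<times> (nat \<Rightarrow> real mat)) set" where
  "parameter_space K p = {(s, S). s > 0 \<and> (\<forall>k\<in>{1..K}. S k \<in> spd_unit_det (p k))}"

definition likelihood ::
    "nat \<Rightarrow> (nat \<Rightarrow> nat) \<Rightarrow> nat \<Rightarrow> array \<Rightarrow> real \<times> (nat \<Rightarrow> real mat) \<Rightarrow> real" where
  "likelihood K p n X = (\<lambda>(s, S).
     mvn_density (s \<cdot>\<^sub>m kronecker (1\<^sub>m n) (kronecker_family S K)) (vectorize K p n X))"

definition is_MLE ::
    "nat \<Rightarrow> (nat \<Rightarrow> nat) \<Rightarrow> nat \<Rightarrow> array \<Rightarrow> real \<times> (nat \<Rightarrow> real mat) \<Rightarrow> bool" where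
  "is_MLE K p n X \<theta> \<longleftrightarrow> is_arg_max (likelihood K p n X) (\<lambda>\<theta>. \<theta> \<in> parameter_space K p) \<theta>"

end

theory Submission
  imports Defs
begin

text \<open>
The proof replaces each covariance factor by its Cholesky factor. Every symmetric positive definite
\<open>\<Sigma> k\<close> of unit determinant is \<open>M k (M k)\<^sup>T\<close> for a lower triangular \<open>M k\<close> with positive diagonal and
unit determinant, and conversely every such product is admissible (\<open>cholesky_unit_det\<close> and
\<open>gram_spd_unit_det\<close>). So the model may be parametrized by the families over which the incredible
HOLQ minimizes.

In this parametrization the covariance of the vectorized data is \<open>s G G\<^sup>T\<close>, where
\<open>G\<close> is the Kronecker product of the identity and \<open>M K, \<dots>, M 1\<close>. It is again lower triangular of
determinant 1, so the normalization of the density depends on \<open>s\<close> alone. Multiplying by \<open>G\<close> is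
multilinear multiplication by \<open>M\<close>, so the data vector is \<open>G w\<close> with \<open>w\<close> the
vectorization of \<open>((M 1)\<^sup>-\<^sup>1, \<dots>, (M K)\<^sup>-\<^sup>1, I) \<cdot> X\<close>, and the exponent of the density is
\<open>- a / (2 s)\<close>, where \<open>a\<close> is the squared norm of that array (\<open>likelihood_gram\<close>). With \<open>N\<close> entries in
the data, the likelihood is \<open>exp (- a / (2 s)) / (2 \<pi> s) powr (N / 2)\<close>.

Hence maximizing over \<open>\<Sigma>\<close> means minimizing \<open>a\<close>, whose minimum \<open>l\<^sup>2\<close> is attained at the factors of
the incredible HOLQ, and maximizing over \<open>s\<close> then gives \<open>s = l\<^sup>2 / N\<close>
(\<open>gaussian_profile_bound\<close>). The equality case of that bound shows that any maximizer has
this scale and that its Cholesky factors minimize \<open>a\<close>, so they form an incredible HOLQ of \<open>X\<close> too.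
\<close>

section \<open>Cholesky factorization\<close>

text \<open>
Eliminate the first row and column. If \<open>\<alpha>\<close> is the corner entry and \<open>\<beta>\<close> the rest of the first
column, the first column of the factor has to be \<open>(sqrt \<alpha>, \<beta> / sqrt \<alpha>)\<close>, and what remains to be
factorized is the Schur complement \<open>a i j - \<beta> i * \<beta> j / \<alpha>\<close> of the other rows and columns. Working
with plain functions makes this step of the induction an index shift instead of a block
decomposition of matrices.
\<close>

lemma cholesky_entries:
  fixes a :: "nat \<Rightarrow> nat \<Rightarrow> real"
  assumes "\<And>i j. i < d \<Longrightarrow> j < d \<Longrightarrow> a i j = a j i"
    and "\<And>v. \<exists>i<d. v i \<noteq> 0 \<Longrightarrow> 0 < (\<Sum>i<d. \<Sum>j<d. v i * a i j * v j)"
  shows "\<exists>m. (\<forall>i<d. 0 < m i i) \<and> (\<forall>i<d. \<forall>j<d. i < j \<longrightarrow> m i j = 0) \<and>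
    (\<forall>i<d. \<forall>j<d. a i j = (\<Sum>k<d. m i k * m j k))"
  using assms
proof (induction d arbitrary: a)
  case 0
  then show ?case by simp
next
  case (Suc d)
  define \<alpha> where "\<alpha> = a 0 0"
  define \<beta> where "\<beta> i = a (Suc i) 0" for i
  define c where "c i j = a (Suc i) (Suc j) - \<beta> i * \<beta> j / \<alpha>" for i j
  have a0: "a 0 (Suc j) = \<beta> j" if "j < d" for j
    using Suc.prems(1)[of 0 "Suc j"] that by (simp add: \<beta>_def)
  have "0 < (\<Sum>i<Suc d. \<Sum>j<Suc d. (if i = 0 then 1 else 0) * a i j * (if j = 0 then 1 else 0))"
    by (rule Suc.prems(2)) auto
  then have \<alpha>: "\<alpha> > 0"
    by (simp add: sum.lessThan_Suc_shift \<alpha>_def del: sum.lessThan_Suc)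
  have c_pos: "0 < (\<Sum>i<d. \<Sum>j<d. w i * c i j * w j)" if w: "\<exists>i<d. w i \<noteq> 0" for w
  proof -
    define b where "b = (\<Sum>i<d. \<beta> i * w i)"
    define q where "q = (\<Sum>i<d. \<Sum>j<d. w i * a (Suc i) (Suc j) * w j)"
    \<comment> \<open>Extending \<open>w\<close> by this value minimizes the quadratic form of \<open>a\<close>; the minimum is the
      quadratic form of the Schur complement at \<open>w\<close>.\<close>
    define t where "t = - b / \<alpha>"
    have 1: "(\<Sum>j<d. t * a 0 (Suc j) * w j) = t * b"
      unfolding b_def sum_distrib_left by (rule sum.cong) (auto simp: a0)
    have 2: "(\<Sum>i<d. w i * a (Suc i) 0 * t) = t * b"
      unfolding b_def sum_distrib_left by (rule sum.cong) (auto simp: \<beta>_def)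
    have "0 < (\<Sum>i<Suc d. \<Sum>j<Suc d. case_nat t w i * a i j * case_nat t w j)"
      using w by (intro Suc.prems(2)) auto
    also have "\<dots> = t * \<alpha> * t + t * b + (t * b + q)"
      by (simp add: sum.lessThan_Suc_shift sum.distrib 1 2 q_def \<alpha>_def del: sum.lessThan_Suc)
    also have "\<dots> = q - b * b / \<alpha>"
      using \<alpha> by (simp add: t_def field_simps)
    also have "b * b / \<alpha> = (\<Sum>i<d. \<Sum>j<d. w i * (\<beta> i * \<beta> j / \<alpha>) * w j)"
      unfolding b_def sum_product sum_divide_distrib by (intro sum.cong) auto
    also have "q - \<dots> = (\<Sum>i<d. \<Sum>j<d. w i * c i j * w j)"
      by (simp add: q_def c_def sum_subtractf algebra_simps)
    finally show ?thesis .
  qed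
  have c_sym: "c i j = c j i" if "i < d" "j < d" for i j
    using Suc.prems(1)[of "Suc i" "Suc j"] that by (simp add: c_def)
  obtain m where m: "\<forall>i<d. 0 < m i i" "\<forall>i<d. \<forall>j<d. i < j \<longrightarrow> m i j = 0"
      "\<forall>i<d. \<forall>j<d. c i j = (\<Sum>k<d. m i k * m j k)"
    using Suc.IH[of c] c_sym c_pos by blast
  define m' where "m' = case_nat (case_nat (sqrt \<alpha>) (\<lambda>_. 0)) (\<lambda>i. case_nat (\<beta> i / sqrt \<alpha>) (m i))"
  have a_eq: "a (Suc i) (Suc j) = \<beta> i * \<beta> j / \<alpha> + (\<Sum>k<d. m i k * m j k)" if "i < d" "j < d" for i j
    using m(3) that by (simp add: c_def field_simps)
  show ?case
  proof (intro exI[of _ m'] conjI allI impI)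
    show "0 < m' i i" if "i < Suc d" for i
      using that m(1) \<alpha> by (auto simp: m'_def split: nat.split)
    show "m' i j = 0" if "i < Suc d" "j < Suc d" "i < j" for i j
      using that m(2) by (auto simp: m'_def split: nat.split)
    show "a i j = (\<Sum>k<Suc d. m' i k * m' j k)" if "i < Suc d" "j < Suc d" for i j
      using that \<alpha> a0
      by (cases i; cases j)
        (auto simp: sum.lessThan_Suc_shift m'_def \<alpha>_def \<beta>_def[symmetric] a_eq
          simp del: sum.lessThan_Suc)
  qed
qed

lemma lower_tri_unit_detD:
  assumes "M \<in> lower_tri_unit_det d"
  shows "M \<in> carrier_mat d d" "det M = 1"
  using assms by (auto simp: lower_tri_unit_det_def)

lemma det_lower_tri:
  fixes M :: "real mat"
  assumes "M \<in> carrier_mat d d" "\<forall>i<d. \<forall>j<d. i < j \<longrightarrow> M $$ (i, j) = 0"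
  shows "det M = (\<Prod>i<d. M $$ (i, i))"
  using det_lower_triangular[of d M] assms
  by (auto simp: prod_list_diag_prod atLeast0LessThan)

lemma minv_nonsingular:
  fixes M :: "real mat"
  assumes "M \<in> carrier_mat d d" "det M \<noteq> 0"
  shows "minv M \<in> carrier_mat d d" "M * minv M = 1\<^sub>m d" "minv M * M = 1\<^sub>m d"
proof -
  have "M \<in> Units (ring_mat TYPE(real) d undefined)"
    by (rule det_non_zero_imp_unit[OF assms])
  then obtain B where "mat_inverse M = Some B"
    using mat_inverse(1)[OF assms(1)] by (metis option.exhaust)
  with mat_inverse(2)[OF assms(1) this]
  show "minv M \<in> carrier_mat d d" "M * minv M = 1\<^sub>m d" "minv M * M = 1\<^sub>m d"
    by auto
qed

lemma scalar_prod_self: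
  fixes v :: "real vec"
  assumes "v \<in> carrier_vec d"
  shows "v \<bullet> v = (\<Sum>i<d. (v $ i)\<^sup>2)"
  using assms by (auto simp: scalar_prod_def power2_eq_square atLeast0LessThan)

text \<open>
The quadratic form at \<open>v\<close> is the squared length of \<open>M\<^sup>T v\<close>, which vanishes only for \<open>v = 0\<close> since
\<open>M\<close> is nonsingular.
\<close>

lemma gram_spd_unit_det:
  assumes M: "M \<in> lower_tri_unit_det d"
  shows "M * transpose_mat M \<in> spd_unit_det d"
proof -
  note Mc = lower_tri_unit_detD[OF M]
  have Mt: "transpose_mat M \<in> carrier_mat d d" using Mc by simp
  have "0 < v \<bullet> ((M * transpose_mat M) *\<^sub>v v)" if v: "v \<in> carrier_vec d" "v \<noteq> 0\<^sub>v d" for v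
  proof -
    define w where "w = transpose_mat M *\<^sub>v v"
    have w: "w \<in> carrier_vec d" using Mt v by (auto simp: w_def)
    have "det (transpose_mat M) \<noteq> 0" using Mc by (simp add: det_transpose)
    note inv = minv_nonsingular[OF Mt this]
    have "v = minv (transpose_mat M) *\<^sub>v w"
      using inv Mt v by (simp add: w_def flip: assoc_mult_mat_vec)
    moreover have "minv (transpose_mat M) *\<^sub>v 0\<^sub>v d = 0\<^sub>v d"
      using inv(1) by auto
    ultimately have "w \<noteq> 0\<^sub>v d" using v by auto
    then obtain i where i: "i < d" "w $ i \<noteq> 0" using w by (metis carrier_vecD eq_vecI index_zero_vec)
    have "v \<bullet> ((M * transpose_mat M) *\<^sub>v v) = w \<bullet> w"
      using Mc Mt v w transpose_vec_mult_scalar[OF Mc(1) w v(1)] by (simp add: w_def)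
    also have "\<dots> = (\<Sum>i<d. (w $ i)\<^sup>2)" by (rule scalar_prod_self[OF w])
    also have "\<dots> > 0" using i by (intro sum_pos2[of _ i]) auto
    finally show ?thesis .
  qed
  moreover have "transpose_mat (M * transpose_mat M) = M * transpose_mat M"
    using transpose_mult[OF Mc(1) Mt] by simp
  moreover have "det (M * transpose_mat M) = 1"
    using det_mult[OF Mc(1) Mt] Mc by (simp add: det_transpose)
  ultimately show ?thesis using Mc by (auto simp: spd_unit_det_def)
qed

text \<open>
The positive diagonal makes \<open>det M\<close> positive, and its square is \<open>det S = 1\<close>. Hence the Cholesky
factor has unit determinant as well.
\<close>

lemma cholesky_unit_det:
  assumes "S \<in> spd_unit_det d"
  obtains M where "M \<in> lower_tri_unit_det d" "S = M * transpose_mat M"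
proof -
  have S: "S \<in> carrier_mat d d" and sym: "transpose_mat S = S" and detS: "det S = 1"
    and pos: "\<And>v. v \<in> carrier_vec d \<Longrightarrow> v \<noteq> 0\<^sub>v d \<Longrightarrow> v \<bullet> (S *\<^sub>v v) > 0"
    using assms by (auto simp: spd_unit_det_def)
  have "\<exists>m. (\<forall>i<d. 0 < m i i) \<and> (\<forall>i<d. \<forall>j<d. i < j \<longrightarrow> m i j = 0) \<and>
    (\<forall>i<d. \<forall>j<d. S $$ (i, j) = (\<Sum>k<d. m i k * m j k))"
  proof (rule cholesky_entries)
    show "S $$ (i, j) = S $$ (j, i)" if "i < d" "j < d" for i j
      using that S index_transpose_mat(1)[of j S i] sym by simp
    show "0 < (\<Sum>i<d. \<Sum>j<d. v i * S $$ (i, j) * v j)" if v: "\<exists>i<d. v i \<noteq> 0" for v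
    proof -
      have "vec d v \<noteq> 0\<^sub>v d" using v by (metis index_vec index_zero_vec(1))
      then have "0 < vec d v \<bullet> (S *\<^sub>v vec d v)" by (intro pos) auto
      also have "\<dots> = (\<Sum>i<d. \<Sum>j<d. v i * S $$ (i, j) * v j)"
        using S by (auto simp: scalar_prod_def sum_distrib_left atLeast0LessThan mult.assoc
            intro!: sum.cong)
      finally show ?thesis .
    qed
  qed
  then obtain m where m: "\<forall>i<d. 0 < m i i" "\<forall>i<d. \<forall>j<d. i < j \<longrightarrow> m i j = 0"
    "\<forall>i<d. \<forall>j<d. S $$ (i, j) = (\<Sum>k<d. m i k * m j k)" by blast
  define M where "M = mat d d (\<lambda>(i, j). m i j)"
  have M: "M \<in> carrier_mat d d" by (simp add: M_def)
  have eq: "S = M * transpose_mat M"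
    using S m(3) by (intro eq_matI) (auto simp: M_def scalar_prod_def atLeast0LessThan)
  have det: "det M = (\<Prod>i<d. M $$ (i, i))"
    by (rule det_lower_tri[OF M]) (use m in \<open>auto simp: M_def\<close>)
  have "det M > 0" unfolding det using m(1) by (intro prod_pos) (auto simp: M_def)
  moreover have "det M * det M = 1"
    using det_mult[OF M, of "transpose_mat M"] M detS eq by (simp add: det_transpose)
  ultimately have "det M = 1" by (simp add: square_eq_1_iff)
  then have "M \<in> lower_tri_unit_det d"
    using m by (auto simp: lower_tri_unit_det_def M_def)
  then show ?thesis using eq that by blast
qed

section \<open>Kronecker products\<close>

lemma kronecker_carrier:
  assumes "A \<in> carrier_mat a a'" "B \<in> carrier_mat b b'"
  shows "kronecker A B \<in> carrier_mat (a * b) (a' * b')"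
  using assms by (auto simp: kronecker_def)

lemma kronecker_index:
  assumes "A \<in> carrier_mat a a'" "B \<in> carrier_mat b b'" "i < a * b" "j < a' * b'"
  shows "kronecker A B $$ (i, j) = A $$ (i div b, j div b') * B $$ (i mod b, j mod b')"
  using assms by (auto simp: kronecker_def)

lemma div_mod_less:
  fixes r :: nat
  assumes "r < a * b"
  shows "r div b < a" "r mod b < b"
proof -
  have "b > 0" using assms by (cases b) auto
  then show "r div b < a" "r mod b < b" using assms by (auto simp: less_mult_imp_div_less)
qed

text \<open>
Quotient and remainder turn the rows and columns of a Kronecker product into pairs of indices of
its factors. Sums and products over such a range thereby split into two independent ones.
\<close>

lemma bij_betw_div_mod:
  "bij_betw (\<lambda>r. (r div b, r mod b)) {..<a * b} ({..<a} \<times> {..<b :: nat})"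
proof (rule bij_betwI[of _ _ _ "\<lambda>(i, j). i * b + j"])
  show "(\<lambda>(i, j). i * b + j) \<in> {..<a} \<times> {..<b} \<rightarrow> {..<a * b}"
  proof clarsimp
    fix i j assume "i < a" "j < b"
    then have "i * b + j < Suc i * b" "Suc i * b \<le> a * b"
      using mult_le_mono1[of "Suc i" a b] by auto
    then show "i * b + j < a * b" by linarith
  qed
qed (auto simp: div_mod_less)

lemma sum_div_mod:
  "(\<Sum>r<a * b. f (r div b) (r mod b)) = (\<Sum>i<a. \<Sum>j<b :: nat. f i j)"
  using sum.reindex_bij_betw[OF bij_betw_div_mod, of "\<lambda>(i, j). f i j" b a]
  by (simp add: sum.cartesian_product)

lemma prod_div_mod:
  "(\<Prod>r<a * b. f (r div b) (r mod b)) = (\<Prod>i<a. \<Prod>j<b :: nat. f i j)"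
  using prod.reindex_bij_betw[OF bij_betw_div_mod, of "\<lambda>(i, j). f i j" b a]
  by (simp add: prod.cartesian_product)

lemma kronecker_mult:
  assumes A: "A \<in> carrier_mat a m" and B: "B \<in> carrier_mat b k"
    and C: "C \<in> carrier_mat m c" and D: "D \<in> carrier_mat k d"
  shows "kronecker A B * kronecker C D = kronecker (A * C) (B * D)"
proof (rule eq_matI)
  have AC: "A * C \<in> carrier_mat a c" and BD: "B * D \<in> carrier_mat b d" using assms by auto
  note carr = kronecker_carrier[OF A B] kronecker_carrier[OF C D] kronecker_carrier[OF AC BD]
  show "dim_row (kronecker A B * kronecker C D) = dim_row (kronecker (A * C) (B * D))"
    "dim_col (kronecker A B * kronecker C D) = dim_col (kronecker (A * C) (B * D))"
    using carr by auto
  fix i j assume "i < dim_row (kronecker (A * C) (B * D))" "j < dim_col (kronecker (A * C) (B * D))"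
  then have ij: "i < a * b" "j < c * d" using carr by auto
  have "(kronecker A B * kronecker C D) $$ (i, j) =
      (\<Sum>r<m * k. kronecker A B $$ (i, r) * kronecker C D $$ (r, j))"
    using carr ij by (auto simp: scalar_prod_def atLeast0LessThan)
  also have "\<dots> = (\<Sum>r<m * k. (A $$ (i div b, r div k) * B $$ (i mod b, r mod k)) *
      (C $$ (r div k, j div d) * D $$ (r mod k, j mod d)))"
    by (intro sum.cong) (simp_all add: kronecker_index[OF A B] kronecker_index[OF C D] ij)
  also have "\<dots> = (\<Sum>x<m. \<Sum>y<k. (A $$ (i div b, x) * B $$ (i mod b, y)) *
      (C $$ (x, j div d) * D $$ (y, j mod d)))"
    by (rule sum_div_mod)
  also have "\<dots> = (\<Sum>x<m. A $$ (i div b, x) * C $$ (x, j div d)) *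
      (\<Sum>y<k. B $$ (i mod b, y) * D $$ (y, j mod d))"
    unfolding sum_product by (intro sum.cong) auto
  also have "\<dots> = kronecker (A * C) (B * D) $$ (i, j)"
    using A B C D ij div_mod_less
    by (simp add: kronecker_index[OF AC BD] scalar_prod_def atLeast0LessThan)
  finally show "(kronecker A B * kronecker C D) $$ (i, j) = kronecker (A * C) (B * D) $$ (i, j)" .
qed

lemma kronecker_transpose:
  assumes A: "A \<in> carrier_mat a a'" and B: "B \<in> carrier_mat b b'"
  shows "transpose_mat (kronecker A B) = kronecker (transpose_mat A) (transpose_mat B)"
proof -
  have "transpose_mat A \<in> carrier_mat a' a" "transpose_mat B \<in> carrier_mat b' b"
    using assms by auto
  note carr = kronecker_carrier[OF A B] kronecker_carrier[OF this] kronecker_index[OF this]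
  show ?thesis
    using A B by (intro eq_matI) (use carr in \<open>auto simp: kronecker_index[OF A B] div_mod_less\<close>)
qed

text \<open>
Rows and columns of the product are ordered lexicographically by quotient and remainder, so an
entry above the diagonal contains a factor above the diagonal of \<open>A\<close> or of \<open>B\<close>. Triangularity
gives the determinant directly as the product of the diagonal entries,
\<open>(det A) ^ b * (det B) ^ a\<close>.
\<close>

lemma kronecker_lower_tri_unit_det:
  assumes "A \<in> lower_tri_unit_det a" "B \<in> lower_tri_unit_det b"
  shows "kronecker A B \<in> lower_tri_unit_det (a * b)"
proof -
  have A: "A \<in> carrier_mat a a" "\<forall>i<a. \<forall>j<a. i < j \<longrightarrow> A $$ (i, j) = 0" "\<forall>i<a. 0 < A $$ (i, i)"
      "det A = 1"
    and B: "B \<in> carrier_mat b b" "\<forall>i<b. \<forall>j<b. i < j \<longrightarrow> B $$ (i, j) = 0" "\<forall>i<b. 0 < B $$ (i, i)"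
      "det B = 1"
    using assms by (auto simp: lower_tri_unit_det_def)
  note ix = kronecker_index[OF A(1) B(1)]
  have zero: "kronecker A B $$ (i, j) = 0" if "i < a * b" "j < a * b" "i < j" for i j
  proof (cases "i div b = j div b")
    case True
    then have "i mod b < j mod b"
      using that(3) by (metis add_less_cancel_left div_mult_mod_eq)
    then show ?thesis
      using B(2) that div_mod_less(2)[OF that(1)] div_mod_less(2)[OF that(2)] by (simp add: ix)
  next
    case False
    then have "i div b < j div b"
      using that(3) by (meson div_le_mono le_neq_implies_less less_imp_le)
    then show ?thesis using A(2) that by (simp add: ix div_mod_less)
  qed
  have detA: "(\<Prod>i<a. A $$ (i, i)) = 1" and detB: "(\<Prod>i<b. B $$ (i, i)) = 1"
    using det_lower_tri A B by auto
  have "det (kronecker A B) = (\<Prod>r<a * b. kronecker A B $$ (r, r))"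
    using zero by (intro det_lower_tri kronecker_carrier A B) auto
  also have "\<dots> = (\<Prod>r<a * b. A $$ (r div b, r div b) * B $$ (r mod b, r mod b))"
    by (intro prod.cong) (auto simp: ix)
  also have "\<dots> = (\<Prod>i<a. \<Prod>j<b. A $$ (i, i) * B $$ (j, j))"
    by (rule prod_div_mod)
  also have "\<dots> = (\<Prod>i<a. A $$ (i, i) ^ b * (\<Prod>j<b. B $$ (j, j)))"
    by (simp add: prod.distrib)
  also have "\<dots> = 1"
    using detA by (simp add: detB prod_power_distrib[symmetric])
  finally have "det (kronecker A B) = 1" .
  moreover have "0 < kronecker A B $$ (r, r)" if "r < a * b" for r
    using A(3) B(3) that by (simp add: ix div_mod_less)
  ultimately show ?thesis
    using zero kronecker_carrier[OF A(1) B(1)] by (auto simp: lower_tri_unit_det_def)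
qed

lemma one_lower_tri_unit_det: "1\<^sub>m d \<in> lower_tri_unit_det d"
  by (auto simp: lower_tri_unit_det_def)

lemma kronecker_family_carrier:
  assumes "\<forall>k\<in>{1..K}. A k \<in> carrier_mat (p k) (p k)"
  shows "kronecker_family A K \<in> carrier_mat (\<Prod>k=1..K. p k) (\<Prod>k=1..K. p k)"
  using assms
proof (induction K)
  case 0
  then show ?case by simp
next
  case (Suc K)
  then show ?case
    using kronecker_carrier[of "A (Suc K)" "p (Suc K)" "p (Suc K)" "kronecker_family A K"
        "\<Prod>k=1..K. p k" "\<Prod>k=1..K. p k"]
    by (simp add: mult.commute)
qed

lemma kronecker_family_lower_tri_unit_det:
  assumes "\<forall>k\<in>{1..K}. M k \<in> lower_tri_unit_det (p k)"
  shows "kronecker_family M K \<in> lower_tri_unit_det (\<Prod>k=1..K. p k)"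
  using assms
proof (induction K)
  case 0
  then show ?case using one_lower_tri_unit_det[of 1] by simp
next
  case (Suc K)
  then show ?case
    using kronecker_lower_tri_unit_det[of "M (Suc K)" "p (Suc K)" "kronecker_family M K" "\<Prod>k=1..K. p k"]
    by (simp add: mult.commute)
qed

text \<open>
The Kronecker product of Gram matrices is the Gram matrix of the Kronecker product, because
Kronecker products commute with matrix products and with transposition.
\<close>

lemma kronecker_family_gram:
  assumes "\<forall>k\<in>{1..K}. M k \<in> lower_tri_unit_det (p k)"
    and "\<forall>k\<in>{1..K}. S k = M k * transpose_mat (M k)"
  shows "kronecker_family S K = kronecker_family M K * transpose_mat (kronecker_family M K)"
  using assms
proof (induction K)
  case 0
  then show ?case by simp
next
  case (Suc K)
  have F: "kronecker_family M K \<in> carrier_mat (\<Prod>k=1..K. p k) (\<Prod>k=1..K. p k)"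
    using kronecker_family_carrier[of K M p] Suc.prems lower_tri_unit_detD by auto
  have M: "M (Suc K) \<in> carrier_mat (p (Suc K)) (p (Suc K))"
    using Suc.prems lower_tri_unit_detD by auto
  show ?case
    using Suc F M kronecker_mult[OF M F, of "transpose_mat (M (Suc K))" _
        "transpose_mat (kronecker_family M K)"]
    by (simp add: kronecker_transpose[OF M F])
qed

section \<open>Mixed-radix digits\<close>

text \<open>
With these digits, position \<open>r\<close> of the vectorization of an array holds its entry at the index
\<open>digits K p r\<close> for the first \<open>K\<close> modes and \<open>r div (\<Prod>k=1..K. p k)\<close> for the last mode.
\<close>

definition digit :: "(nat \<Rightarrow> nat) \<Rightarrow> nat \<Rightarrow> nat \<Rightarrow> nat" where
  "digit p k r = (r div (\<Prod>m=1..<k. p m)) mod p k"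

definition digits :: "nat \<Rightarrow> (nat \<Rightarrow> nat) \<Rightarrow> nat \<Rightarrow> nat \<Rightarrow> nat" where
  "digits K p r = (\<lambda>k\<in>{1..K}. digit p k r)"

lemma mod_prod_Suc:
  "r mod (\<Prod>k=1..Suc K. p k) = (\<Prod>k=1..K. p k) * digit p (Suc K) r + r mod (\<Prod>k=1..K. p k)"
  by (simp add: digit_def atLeastLessThanSuc_atLeastAtMost mod_mult2_eq)

lemma digit_mod:
  fixes p :: "nat \<Rightarrow> nat"
  assumes "1 \<le> k" "k \<le> K"
  shows "digit p k (r mod (\<Prod>k=1..K. p k)) = digit p k r"
proof -
  define D where "D = (\<Prod>m=1..<k. p m)"
  have "{1..K} = {1..<k} \<union> {k..K}" using assms by auto
  then have "(\<Prod>k=1..K. p k) = D * (\<Prod>m=k..K. p m)"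
    by (simp add: D_def prod.union_disjoint[symmetric] ivl_disj_int)
  also have "(\<Prod>m=k..K. p m) = p k * (\<Prod>m=Suc k..K. p m)"
    using assms by (simp add: prod.atLeast_Suc_atMost)
  finally have P: "(\<Prod>k=1..K. p k) = D * (p k * (\<Prod>m=Suc k..K. p m))" .
  show ?thesis
    unfolding digit_def D_def[symmetric] P
    by (cases "D = 0") (simp_all add: mod_mult2_eq mod_mult_self2)
qed

lemma digits_mod:
  "digits K p (r mod (\<Prod>k=1..K. p k)) = digits K p r"
  unfolding digits_def by (rule restrict_ext, rule digit_mod) auto

text \<open>
The first \<open>J\<close> digits determine the position modulo \<open>p 1 * \<dots> * p J\<close>, by induction on \<open>J\<close>; hence the
digits are injective. There are as many positions as multi-indices, so they are also surjective.
\<close>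

lemma bij_betw_digits:
  assumes p: "\<forall>k\<in>{1..K}. p k \<ge> 1"
  shows "bij_betw (digits K p) {..<\<Prod>k=1..K. p k} (multi_indices K p)"
proof -
  have inj: "inj_on (digits K p) {..<\<Prod>k=1..K. p k}"
  proof (rule inj_onI)
    fix r r' assume less: "r \<in> {..<\<Prod>k=1..K. p k}" "r' \<in> {..<\<Prod>k=1..K. p k}"
      and eq: "digits K p r = digits K p r'"
    have deq: "digit p k r = digit p k r'" if "k \<in> {1..K}" for k
      using fun_cong[OF eq, of k] that by (simp add: digits_def)
    have "r mod (\<Prod>k=1..J. p k) = r' mod (\<Prod>k=1..J. p k)" if "J \<le> K" for J
      using that
    proof (induction J)
      case (Suc J)
      then show ?case unfolding mod_prod_Suc using deq[of "Suc J"] by simp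
    qed simp
    from this[of K] less show "r = r'" by simp
  qed
  have "digits K p r \<in> multi_indices K p" for r
    using p by (fastforce simp: digits_def digit_def multi_indices_def Suc_le_eq)
  moreover have "finite (multi_indices K p)" "card (multi_indices K p) = (\<Prod>k=1..K. p k)"
    by (auto simp: multi_indices_def card_PiE intro!: finite_PiE)
  ultimately have "digits K p ` {..<\<Prod>k=1..K. p k} = multi_indices K p"
    by (intro card_subset_eq) (auto simp: card_image[OF inj] simp del: One_nat_def)
  with inj show ?thesis by (simp add: bij_betw_def)
qed

lemma kronecker_family_index:
  assumes "\<forall>k\<in>{1..K}. A k \<in> carrier_mat (p k) (p k)"
    and "r < (\<Prod>k=1..K. p k)" "c < (\<Prod>k=1..K. p k)"
  shows "kronecker_family A K $$ (r, c) = (\<Prod>k=1..K. A k $$ (digit p k r, digit p k c))"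
  using assms
proof (induction K arbitrary: r c)
  case 0
  then show ?case by simp
next
  case (Suc K)
  define P where "P = (\<Prod>k=1..K. p k)"
  have rc: "r < p (Suc K) * P" "c < p (Suc K) * P" using Suc.prems by (auto simp: P_def mult.commute)
  have P0: "P > 0" using rc by (cases P) auto
  have A: "A (Suc K) \<in> carrier_mat (p (Suc K)) (p (Suc K))"
    and A': "\<forall>k\<in>{1..K}. A k \<in> carrier_mat (p k) (p k)" using Suc.prems by auto
  have F: "kronecker_family A K \<in> carrier_mat P P"
    using kronecker_family_carrier[OF A'] by (simp add: P_def)
  have ix: "kronecker_family A K $$ (r mod P, c mod P) =
      (\<Prod>k=1..K. A k $$ (digit p k (r mod P), digit p k (c mod P)))"
    using Suc.IH[OF A', of "r mod P" "c mod P"] P0 by (simp add: P_def)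
  have dig: "x div P = digit p (Suc K) x" if "x < p (Suc K) * P" for x
    using div_mod_less(1)[OF that] by (simp add: digit_def P_def atLeastLessThanSuc_atLeastAtMost)
  have ix': "kronecker_family A K $$ (r mod P, c mod P) =
      (\<Prod>k=1..K. A k $$ (digit p k r, digit p k c))"
    unfolding ix unfolding P_def by (intro prod.cong) (auto simp: digit_mod simp del: One_nat_def)
  show ?case
    by (simp add: kronecker_index[OF A F rc] ix' dig[OF rc(1)] dig[OF rc(2)] mult.commute)
qed

section \<open>Multilinear multiplication\<close>

lemma finite_multi_indices: "finite (multi_indices K p)"
  by (auto simp: multi_indices_def intro!: finite_PiE)

lemma multi_indicesD: "j \<in> multi_indices K p \<Longrightarrow> k \<in> {1..K} \<Longrightarrow> j k < p k"
  by (auto simp: multi_indices_def)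

lemma multilinear_cong:
  assumes "\<And>k. k \<in> {1..K} \<Longrightarrow> A k = B k"
  shows "multilinear K p A Y j m = multilinear K p B Y j m"
  using assms by (auto simp: multilinear_def)

text \<open>
For fixed outer indices, the sum over the intermediate multi-index of a product over the modes is
the product over the modes of sums over a single index, and these sums are the entries of the
matrix products.
\<close>

lemma multilinear_compose:
  assumes A: "\<forall>k\<in>{1..K}. A k \<in> carrier_mat (p k) (p k)"
    and B: "\<forall>k\<in>{1..K}. B k \<in> carrier_mat (p k) (p k)"
    and j: "j \<in> multi_indices K p"
  shows "multilinear K p A (multilinear K p B Y) j m = multilinear K p (\<lambda>k. A k * B k) Y j m"
proof -
  let ?I = "multi_indices K p"
  have entry: "(\<Sum>i\<in>?I. \<Prod>k=1..K. A k $$ (j k, i k) * B k $$ (i k, h k)) =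
      (\<Prod>k=1..K. (A k * B k) $$ (j k, h k))" if h: "h \<in> ?I" for h
  proof -
    have "(A k * B k) $$ (j k, h k) = (\<Sum>x<p k. A k $$ (j k, x) * B k $$ (x, h k))"
      if "k \<in> {1..K}" for k
      using A[rule_format, OF that] B[rule_format, OF that] that
        multi_indicesD[OF j that] multi_indicesD[OF h that]
      by (simp add: scalar_prod_def atLeast0LessThan)
    then show ?thesis
      by (simp add: multi_indices_def prod_sum_PiE)
  qed
  have "multilinear K p A (multilinear K p B Y) j m =
      (\<Sum>i\<in>?I. \<Sum>h\<in>?I. Y h m * (\<Prod>k=1..K. A k $$ (j k, i k) * B k $$ (i k, h k)))"
    unfolding multilinear_def sum_distrib_right prod.distrib by (intro sum.cong) simp_all
  also have "\<dots> = (\<Sum>h\<in>?I. Y h m * (\<Sum>i\<in>?I. \<Prod>k=1..K. A k $$ (j k, i k) * B k $$ (i k, h k)))"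
    by (subst sum.swap) (simp add: sum_distrib_left)
  also have "\<dots> = multilinear K p (\<lambda>k. A k * B k) Y j m"
    unfolding multilinear_def by (intro sum.cong) (simp_all only: entry)
  finally show ?thesis .
qed

lemma multilinear_one:
  assumes j: "j \<in> multi_indices K p"
  shows "multilinear K p (\<lambda>k. 1\<^sub>m (p k)) Y j m = Y j m"
proof -
  have "(\<Prod>k=1..K. (1\<^sub>m (p k) :: real mat) $$ (j k, i k)) = (if i = j then 1 else 0)"
    if i: "i \<in> multi_indices K p" for i
  proof -
    have "\<exists>k\<in>{1..K}. j k \<noteq> i k" if "i \<noteq> j"
      using that PiE_ext[OF i[unfolded multi_indices_def] j[unfolded multi_indices_def]] by metis
    moreover have "(1\<^sub>m (p k) :: real mat) $$ (j k, i k) = (if j k = i k then 1 else 0)"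
      if "k \<in> {1..K}" for k
      using multi_indicesD[OF i that] multi_indicesD[OF j that] by simp
    ultimately show ?thesis by (auto intro!: prod_zero)
  qed
  then have "multilinear K p (\<lambda>k. 1\<^sub>m (p k)) Y j m =
      (\<Sum>i\<in>multi_indices K p. if i = j then Y i m else 0)"
    unfolding multilinear_def by (intro sum.cong) auto
  then show ?thesis using j by (simp add: finite_multi_indices)
qed

text \<open>
Whitening is undone by multiplying with the factors themselves. For the data array this recovers the
decomposition \<open>X = l (M 1, \<dots>, M K, I) \<cdot> R\<close> from the array \<open>R\<close> that whitening and dividing by \<open>l\<close>
produces.
\<close>

lemma multilinear_minv_cancel:
  assumes "\<forall>k\<in>{1..K}. M k \<in> lower_tri_unit_det (p k)"
  shows "array_eq K p n (multilinear K p M (multilinear K p (\<lambda>k. minv (M k)) Y)) Y"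
proof -
  have "M k \<in> carrier_mat (p k) (p k) \<and> minv (M k) \<in> carrier_mat (p k) (p k) \<and>
      M k * minv (M k) = 1\<^sub>m (p k)" if "k \<in> {1..K}" for k
    using lower_tri_unit_detD[of "M k" "p k"] minv_nonsingular[of "M k" "p k"] assms that by simp
  then have "multilinear K p M (multilinear K p (\<lambda>k. minv (M k)) Y) j m = Y j m"
    if "j \<in> multi_indices K p" for j m
    using that multilinear_compose[of K M p "\<lambda>k. minv (M k)" j Y m] multilinear_one[OF that, of Y m]
      multilinear_cong[of K "\<lambda>k. M k * minv (M k)" "\<lambda>k. 1\<^sub>m (p k)" p Y j m]
    by auto
  then show ?thesis by (simp add: array_eq_def)
qed

section \<open>Vectorization\<close>

lemma vectorize_carrier: "vectorize K p n Y \<in> carrier_vec (n * (\<Prod>k=1..K. p k))"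
  by (simp add: vectorize_def)

lemma vectorize_index:
  "r < n * (\<Prod>k=1..K. p k) \<Longrightarrow>
    vectorize K p n Y $ r = Y (digits K p (r mod (\<Prod>k=1..K. p k))) (r div (\<Prod>k=1..K. p k))"
  unfolding digits_mod by (simp add: vectorize_def digits_def digit_def)

lemma vectorize_cong:
  assumes "array_eq K p n Y Z" "\<forall>k\<in>{1..K}. p k \<ge> 1"
  shows "vectorize K p n Y = vectorize K p n Z"
proof (rule eq_vecI)
  show "dim_vec (vectorize K p n Y) = dim_vec (vectorize K p n Z)" by (simp add: vectorize_def)
  fix r assume "r < dim_vec (vectorize K p n Z)"
  then have r: "r < n * (\<Prod>k=1..K. p k)" by (simp add: vectorize_def)
  have "digits K p (r mod (\<Prod>k=1..K. p k)) \<in> multi_indices K p"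
    using div_mod_less(2)[OF r] bij_betwE[OF bij_betw_digits[OF assms(2)]] by blast
  then show "vectorize K p n Y $ r = vectorize K p n Z $ r"
    using assms(1) div_mod_less(1)[OF r] by (simp add: vectorize_index[OF r] array_eq_def)
qed

lemma vectorize_norm:
  assumes "\<forall>k\<in>{1..K}. p k \<ge> 1"
  shows "vectorize K p n Y \<bullet> vectorize K p n Y = (frobenius_norm K p n Y)\<^sup>2"
proof -
  define P where "P = (\<Prod>k=1..K. p k)"
  have "vectorize K p n Y \<bullet> vectorize K p n Y = (\<Sum>r<n * P. (vectorize K p n Y $ r)\<^sup>2)"
    unfolding P_def by (rule scalar_prod_self[OF vectorize_carrier])
  also have "\<dots> = (\<Sum>r<n * P. (Y (digits K p (r mod P)) (r div P))\<^sup>2)"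
    unfolding P_def by (intro sum.cong) (simp_all add: vectorize_index)
  also have "\<dots> = (\<Sum>j<n. \<Sum>i<P. (Y (digits K p i) j)\<^sup>2)"
    by (rule sum_div_mod)
  also have "\<dots> = (\<Sum>j<n. \<Sum>i\<in>multi_indices K p. (Y i j)\<^sup>2)"
    unfolding P_def by (intro sum.cong sum.reindex_bij_betw bij_betw_digits assms) auto
  also have "\<dots> = (frobenius_norm K p n Y)\<^sup>2"
    unfolding frobenius_norm_def by (subst sum.swap) (simp add: sum_nonneg)
  finally show ?thesis .
qed

text \<open>
Multilinear multiplication of arrays is multiplication by a Kronecker product after vectorization.
The identity factor selects the terms with the last-mode index of row \<open>r\<close>, and the digits translate
the remaining sum over columns into a sum over multi-indices.
\<close>

lemma kronecker_mult_vectorize: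
  assumes A: "\<forall>k\<in>{1..K}. A k \<in> carrier_mat (p k) (p k)" and p: "\<forall>k\<in>{1..K}. p k \<ge> 1"
  shows "kronecker (1\<^sub>m n) (kronecker_family A K) *\<^sub>v vectorize K p n Y =
    vectorize K p n (multilinear K p A Y)"
proof -
  define P where "P = (\<Prod>k=1..K. p k)"
  have F: "kronecker_family A K \<in> carrier_mat P P"
    using kronecker_family_carrier[OF A] by (simp add: P_def)
  have one: "1\<^sub>m n \<in> carrier_mat n n" by simp
  note G = kronecker_carrier[OF one F]
  note bij = bij_betw_digits[OF p, folded P_def]
  have vc: "dim_vec (vectorize K p n Z) = n * P" for Z
    using vectorize_carrier[of K p n Z] by (simp add: P_def)
  show ?thesis
  proof (rule eq_vecI)
    show "dim_vec (kronecker (1\<^sub>m n) (kronecker_family A K) *\<^sub>v vectorize K p n Y) =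
      dim_vec (vectorize K p n (multilinear K p A Y))"
      using G vc by simp
    fix r assume "r < dim_vec (vectorize K p n (multilinear K p A Y))"
    then have r: "r < n * P" by (simp add: vc)
    have vec_ix: "vectorize K p n Y $ c = Y (digits K p (c mod P)) (c div P)" if "c < n * P" for c
      using vectorize_index[of c n p K] that by (simp add: P_def)
    have entry: "kronecker_family A K $$ (x, y) = (\<Prod>k=1..K. A k $$ (digits K p x k, digits K p y k))"
      if "x < P" "y < P" for x y
      using kronecker_family_index[OF A, of x y] that by (simp add: P_def digits_def)
    have "(kronecker (1\<^sub>m n) (kronecker_family A K) *\<^sub>v vectorize K p n Y) $ r =
        (\<Sum>c<n * P. kronecker (1\<^sub>m n) (kronecker_family A K) $$ (r, c) * vectorize K p n Y $ c)"
      using G r vc by (simp add: scalar_prod_def atLeast0LessThan)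
    also have "\<dots> = (\<Sum>c<n * P. (if r div P = c div P then 1 else 0) *
        kronecker_family A K $$ (r mod P, c mod P) * Y (digits K p (c mod P)) (c div P))"
      using r by (intro sum.cong)
        (auto simp: kronecker_index[OF one F] div_mod_less vec_ix)
    also have "\<dots> = (\<Sum>j<n. \<Sum>y<P. (if r div P = j then 1 else 0) *
        kronecker_family A K $$ (r mod P, y) * Y (digits K p y) j)"
      by (rule sum_div_mod)
    also have "\<dots> = (\<Sum>j<n. if r div P = j
        then \<Sum>y<P. kronecker_family A K $$ (r mod P, y) * Y (digits K p y) j else 0)"
      by (intro sum.cong) auto
    also have "\<dots> = (\<Sum>y<P. kronecker_family A K $$ (r mod P, y) * Y (digits K p y) (r div P))"
      using div_mod_less(1)[OF r] by simp
    also have "\<dots> = (\<Sum>y<P. Y (digits K p y) (r div P) *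
        (\<Prod>k=1..K. A k $$ (digits K p (r mod P) k, digits K p y k)))"
      using div_mod_less(2)[OF r] by (intro sum.cong) (auto simp: entry)
    also have "\<dots> = multilinear K p A Y (digits K p (r mod P)) (r div P)"
      unfolding multilinear_def using sum.reindex_bij_betw[OF bij] by fastforce
    also have "\<dots> = vectorize K p n (multilinear K p A Y) $ r"
      using vectorize_index[of r n p K] r by (simp add: P_def)
    finally show "(kronecker (1\<^sub>m n) (kronecker_family A K) *\<^sub>v vectorize K p n Y) $ r =
      vectorize K p n (multilinear K p A Y) $ r" .
  qed
qed

section \<open>The likelihood\<close>

text \<open>
If the covariance is \<open>s G G\<^sup>T\<close>, a vector \<open>G w\<close> is as likely as the whitened vector \<open>w\<close> under
covariance \<open>s I\<close>: the quadratic form \<open>w\<^sup>T G\<^sup>T (s G G\<^sup>T)\<^sup>-\<^sup>1 G w\<close> is \<open>w\<^sup>T w / s\<close>, and \<open>det G = 1\<close>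
removes \<open>G\<close> from the normalization.
\<close>

lemma mvn_density_gram:
  assumes G: "G \<in> lower_tri_unit_det d" and w: "w \<in> carrier_vec d" and s: "s > 0"
  shows "mvn_density (s \<cdot>\<^sub>m (G * transpose_mat G)) (G *\<^sub>v w) =
    exp (- (w \<bullet> w) / (2 * s)) / sqrt ((2 * pi * s) ^ d)"
proof -
  note Gc = lower_tri_unit_detD[OF G]
  have Gt: "transpose_mat G \<in> carrier_mat d d" using Gc by simp
  define C where "C = s \<cdot>\<^sub>m (G * transpose_mat G)"
  have C: "C \<in> carrier_mat d d" using Gc by (simp add: C_def)
  have detC: "det C = s ^ d"
    using Gc det_mult[OF Gc(1) Gt] by (simp add: C_def det_transpose)
  note inv = minv_nonsingular[OF C]
  define v where "v = G *\<^sub>v w"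
  have v: "v \<in> carrier_vec d" using Gc w by (auto simp: v_def)
  define y where "y = minv C *\<^sub>v v"
  have y: "y \<in> carrier_vec d" using inv s v detC by (auto simp: y_def)
  define z where "z = transpose_mat G *\<^sub>v y"
  have z: "z \<in> carrier_vec d" using Gt y by (auto simp: z_def)
  have "C *\<^sub>v y = v"
    using inv s v detC C by (simp add: y_def flip: assoc_mult_mat_vec)
  moreover have "C *\<^sub>v y = G *\<^sub>v (s \<cdot>\<^sub>v z)"
  proof -
    have "C *\<^sub>v y = s \<cdot>\<^sub>v ((G * transpose_mat G) *\<^sub>v y)"
      unfolding C_def by (rule eq_vecI) (use Gc Gt y in \<open>simp_all del: assoc_mult_mat_vec\<close>)
    also have "\<dots> = G *\<^sub>v (s \<cdot>\<^sub>v z)"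
      using Gc Gt y z by (simp add: z_def mult_mat_vec[OF Gc(1)])
    finally show ?thesis .
  qed
  ultimately have "minv G *\<^sub>v (G *\<^sub>v (s \<cdot>\<^sub>v z)) = minv G *\<^sub>v (G *\<^sub>v w)"
    by (simp add: v_def)
  then have sz: "s \<cdot>\<^sub>v z = w"
    using minv_nonsingular[OF Gc(1)] Gc z w by (simp flip: assoc_mult_mat_vec)
  have "v \<bullet> y = y \<bullet> (G *\<^sub>v w)"
    using v y by (simp add: comm_scalar_prod v_def)
  also have "\<dots> = z \<bullet> w"
    using transpose_vec_mult_scalar[OF Gc(1) w y] by (simp add: z_def)
  also have "\<dots> = (w \<bullet> w) / s"
    unfolding sz[symmetric] using z s by simp
  finally have "v \<bullet> (minv C *\<^sub>v v) = (w \<bullet> w) / s" by (simp add: y_def)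
  then show ?thesis
    using v by (simp add: mvn_density_def detC power_mult_distrib mult.commute flip: C_def v_def)
qed

text \<open>
The likelihood depends on the covariance factors only through the objective function of the
incredible HOLQ. The data vector is \<open>G w\<close> for the Kronecker product \<open>G\<close> of the Cholesky factors and
the vectorization \<open>w\<close> of the whitened array, whose squared length is the squared Frobenius norm.
\<close>

lemma likelihood_gram:
  assumes M: "\<forall>k\<in>{1..K}. M k \<in> lower_tri_unit_det (p k)"
    and S: "\<forall>k\<in>{1..K}. S k = M k * transpose_mat (M k)"
    and p: "\<forall>k\<in>{1..K}. p k \<ge> 1" and s: "s > 0"
  shows "likelihood K p n X (s, S) =
    exp (- (holq_objective K p n X M)\<^sup>2 / (2 * s)) / sqrt ((2 * pi * s) ^ (n * (\<Prod>k=1..K. p k)))"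
proof -
  define G where "G = kronecker (1\<^sub>m n) (kronecker_family M K)"
  define Y where "Y = multilinear K p (\<lambda>k. minv (M k)) X"
  note F = kronecker_family_lower_tri_unit_det[OF M]
  note Fc = lower_tri_unit_detD(1)[OF F]
  have G: "G \<in> lower_tri_unit_det (n * (\<Prod>k=1..K. p k))"
    unfolding G_def by (intro kronecker_lower_tri_unit_det one_lower_tri_unit_det F)
  have one: "(1\<^sub>m n :: real mat) \<in> carrier_mat n n" by simp
  have "kronecker (1\<^sub>m n) (kronecker_family S K) = G * transpose_mat G"
    using kronecker_mult[OF one Fc one, of "transpose_mat (kronecker_family M K)"] Fc
    by (simp add: G_def kronecker_family_gram[OF M S] kronecker_transpose[OF one Fc])
  moreover have "vectorize K p n X = G *\<^sub>v vectorize K p n Y"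
    using vectorize_cong[OF multilinear_minv_cancel[OF M, of n X] p] M p lower_tri_unit_detD(1)
    by (simp add: G_def Y_def kronecker_mult_vectorize)
  ultimately show ?thesis
    by (simp add: likelihood_def mvn_density_gram[OF G vectorize_carrier s] vectorize_norm[OF p]
        holq_objective_def Y_def)
qed

text \<open>
For fixed \<open>s\<close> the likelihood decreases in the residual sum of squares \<open>a\<close>, and for \<open>a = b\<close> the best
scale is \<open>s = b / N\<close>. With \<open>t = b / (N s)\<close>, the bound and the likelihood differ in their logarithms by
\<open>(a - b) / (2 s) + N / 2 * (t - 1 - ln t)\<close>. Both terms are nonnegative; they vanish exactly for \<open>a = b\<close>
and for \<open>t = 1\<close>.
\<close>

lemma gaussian_profile_bound:
  fixes a b s :: real and N :: nat
  assumes N: "N > 0" and b: "0 < b" "b \<le> a" and s: "s > 0"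
  defines "g \<equiv> \<lambda>a s. exp (- a / (2 * s)) / sqrt ((2 * pi * s) ^ N)"
    and "v \<equiv> (2 * pi * (b / N)) powr (- real N / 2) * exp (- real N / 2)"
  shows "g a s \<le> v" "g a s = v \<longleftrightarrow> a = b \<and> s = b / N"
proof -
  define t where "t = b / (N * s)"
  have t: "t > 0" using N b s by (simp add: t_def)
  have "sqrt ((2 * pi * s) ^ N) = exp (real N / 2 * ln (2 * pi * s))"
    using s by (simp add: powr_def flip: powr_half_sqrt powr_realpow)
  then have g: "g a s = exp (- a / (2 * s) - real N / 2 * ln (2 * pi * s))"
    by (simp add: g_def exp_diff)
  have "2 * pi * (b / N) = (2 * pi * s) * t"
    using N s by (simp add: t_def)
  then have "ln (2 * pi * (b / N)) = ln (2 * pi * s) + ln t"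
    using s t by (simp only: ln_mult_pos[of "2 * pi * s" t]) (simp add: ln_mult_pos)
  then have v: "v = exp (- real N / 2 - real N / 2 * (ln (2 * pi * s) + ln t))"
    using N b by (simp add: v_def powr_def exp_add[symmetric] exp_diff[symmetric])
  have a: "a / (2 * s) = (a - b) / (2 * s) + real N / 2 * t"
    using N s by (simp add: t_def field_simps)
  have lt: "real N / 2 * (t - 1 - ln t) \<ge> 0"
    using N ln_le_minus_one[OF t] by simp
  have ab: "(a - b) / (2 * s) \<ge> 0" using b s by simp
  have diff: "- real N / 2 - real N / 2 * (ln (2 * pi * s) + ln t) -
      (- a / (2 * s) - real N / 2 * ln (2 * pi * s)) =
      (a - b) / (2 * s) + real N / 2 * (t - 1 - ln t)"
  proof -
    define x where "x = (a - b) / (2 * s)"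
    define c where "c = real N / 2"
    have "- a / (2 * s) = - (x + c * t)" and "- real N / 2 = - c"
      using a by (simp_all add: x_def c_def)
    then show ?thesis
      unfolding x_def[symmetric] c_def[symmetric] by (simp only: right_diff_distrib distrib_left)
  qed
  show "g a s \<le> v" unfolding g v using lt ab diff by simp
  have "g a s = v \<longleftrightarrow> (a - b) / (2 * s) + real N / 2 * (t - 1 - ln t) = 0"
    unfolding g v using diff by auto
  also have "\<dots> \<longleftrightarrow> a = b \<and> ln t = t - 1"
    using add_nonneg_eq_0_iff[OF ab lt] N s by auto
  also have "ln t = t - 1 \<longleftrightarrow> t = 1"
    using ln_eq_minus_one[OF t] by auto
  also have "t = 1 \<longleftrightarrow> s = b / N"
    using N s by (auto simp: t_def field_simps)
  finally show "g a s = v \<longleftrightarrow> a = b \<and> s = b / N" .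
qed

section \<open>Maximum likelihood estimates\<close>

theorem theorem3:
  fixes K n :: nat and p :: "nat \<Rightarrow> nat"
    and X Q :: array and l :: real and L :: "nat \<Rightarrow> real mat"
  assumes "K \<ge> 1" and "n \<ge> 1" and "\<forall>k\<in>{1..K}. p k \<ge> 1"
    and "incredible_HOLQ K p n X l L Q"
  defines "P \<equiv> (\<Prod>k=1..K. p k)"
  defines "Sigma_hat \<equiv> (\<lambda>k. L k * transpose_mat (L k))"
    and "sigma2_hat \<equiv> l\<^sup>2 / real (n * P)"
  shows "is_MLE K p n X (sigma2_hat, Sigma_hat) \<and>
    (\<forall>s S. is_MLE K p n X (s, S) \<longrightarrow>
       s = sigma2_hat \<and>
       (\<exists>M R. incredible_HOLQ K p n X l M R \<and>
              (\<forall>k\<in>{1..K}. S k = M k * transpose_mat (M k)))) \<and>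
    likelihood K p n X (sigma2_hat, Sigma_hat) =
      (2 * pi * sigma2_hat) powr (- real (n * P) / 2) * exp (- real (n * P) / 2) \<and>
    (2 * pi * sigma2_hat) powr (- real (n * P) / 2) * exp (- real (n * P) / 2) =
      (2 * pi * l\<^sup>2 / real (n * P)) powr (- real (n * P) / 2) * exp (- real (n * P) / 2)"
proof -
  note p = assms(3)
  let ?feasible = "\<lambda>M. \<forall>k\<in>{1..K}. M k \<in> lower_tri_unit_det (p k)"
  let ?obj = "holq_objective K p n X"
  \<comment> \<open>The claimed maximum of the likelihood.\<close>
  define v where "v = (2 * pi * sigma2_hat) powr (- real (n * P) / 2) * exp (- real (n * P) / 2)"
  have L: "?feasible L" and l: "l = ?obj L" "l > 0"
    and min: "\<And>M. ?feasible M \<Longrightarrow> l \<le> ?obj M"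
    using assms(4) by (auto simp: incredible_HOLQ_def is_arg_min_def not_less)
  have N: "n * P > 0" using assms(2) p by (auto simp: P_def intro!: prod_pos)
  have sigma2: "sigma2_hat > 0" using N l by (simp add: sigma2_hat_def)
  have bound: "likelihood K p n X (s, S) \<le> v \<and>
      (likelihood K p n X (s, S) = v \<longleftrightarrow> ?obj M = l \<and> s = sigma2_hat)"
    if "s > 0" and M: "?feasible M" and S: "\<forall>k\<in>{1..K}. S k = M k * transpose_mat (M k)" for s S M
  proof -
    have "l\<^sup>2 \<le> (?obj M)\<^sup>2" using min[OF M] l(2) by (intro power_mono) auto
    moreover have "(?obj M)\<^sup>2 = l\<^sup>2 \<longleftrightarrow> ?obj M = l"
      using min[OF M] l(2) by (auto simp: power2_eq_iff)
    ultimately show ?thesis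
      using gaussian_profile_bound[OF N, of "l\<^sup>2" "(?obj M)\<^sup>2" s] l(2) \<open>s > 0\<close>
      by (simp add: likelihood_gram[OF M S p \<open>s > 0\<close>] v_def sigma2_hat_def P_def)
  qed
  have factor: "\<exists>M. ?feasible M \<and> (\<forall>k\<in>{1..K}. S k = M k * transpose_mat (M k))"
    if "\<forall>k\<in>{1..K}. S k \<in> spd_unit_det (p k)" for S
  proof -
    have "\<forall>k\<in>{1..K}. \<exists>M. M \<in> lower_tri_unit_det (p k) \<and> S k = M * transpose_mat M"
      using that cholesky_unit_det by metis
    then show ?thesis by metis
  qed
  have max: "likelihood K p n X \<theta> \<le> v" if "\<theta> \<in> parameter_space K p" for \<theta>
    using that factor bound by (fastforce simp: parameter_space_def)
  have attained: "likelihood K p n X (sigma2_hat, Sigma_hat) = v"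
    using bound[OF sigma2 L, of Sigma_hat] l by (simp add: Sigma_hat_def)
  have hat: "(sigma2_hat, Sigma_hat) \<in> parameter_space K p"
    using sigma2 L gram_spd_unit_det by (auto simp: parameter_space_def Sigma_hat_def)
  have "is_MLE K p n X (sigma2_hat, Sigma_hat)"
    using hat max attained by (auto simp: is_MLE_def is_arg_max_def not_less)
  moreover have "s = sigma2_hat \<and> (\<exists>M R. incredible_HOLQ K p n X l M R \<and>
      (\<forall>k\<in>{1..K}. S k = M k * transpose_mat (M k)))" if mle: "is_MLE K p n X (s, S)" for s S
  proof -
    have par: "(s, S) \<in> parameter_space K p" using mle by (simp add: is_MLE_def is_arg_max_def)
    then obtain M where M: "?feasible M" "\<forall>k\<in>{1..K}. S k = M k * transpose_mat (M k)" and s: "s > 0"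
      using factor[of S] by (auto simp: parameter_space_def)
    have "v \<le> likelihood K p n X (s, S)"
      using mle hat attained by (auto simp: is_MLE_def is_arg_max_def not_less)
    then have eq: "?obj M = l" "s = sigma2_hat"
      using bound[OF s M] by auto
    have minimal: "\<not> ?obj M' < ?obj M" if "?feasible M'" for M'
      using min[OF that] eq(1) by simp
    define R where "R = (\<lambda>i j. multilinear K p (\<lambda>k. minv (M k)) X i j / l)"
    have "l * multilinear K p M R i j =
        multilinear K p M (multilinear K p (\<lambda>k. minv (M k)) X) i j" for i j
      using l(2) by (simp add: multilinear_def[of K p M] R_def sum_distrib_left)
    then have "array_eq K p n X (\<lambda>i j. l * multilinear K p M R i j)"
      using multilinear_minv_cancel[OF M(1), of n X] by (simp add: array_eq_def)
    moreover have "is_arg_min ?obj ?feasible M"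
      using M(1) minimal unfolding is_arg_min_def by blast
    ultimately have "incredible_HOLQ K p n X l M R"
      using eq(1) l(2) by (simp add: incredible_HOLQ_def array_eq_def R_def)
    then show ?thesis using eq M by blast
  qed
  moreover have "2 * pi * sigma2_hat = 2 * pi * l\<^sup>2 / real (n * P)"
    by (simp add: sigma2_hat_def)
  then have "v = (2 * pi * l\<^sup>2 / real (n * P)) powr (- real (n * P) / 2) * exp (- real (n * P) / 2)"
    unfolding v_def by (rule arg_cong)
  ultimately show ?thesis
    using attained unfolding v_def by blast
qed

end
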